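(* Let $ABC$ be a triangle with side lengths $a=BC$, $b=CA$, $c=AB$ and angles $A,B,C$ at the corresponding vertices. For a point $P$ in the plane of $ABC$, with barycentric coordinates $(\alpha,\beta,\gamma)$ with respect to $ABC$, $\alpha+\beta+\gamma=1$, let $A_1B_1C_1$ be the pedal triangle of $P$ with respect to $ABC$. Then the locus $\mathcal{L}$ of the points $P$ such that the triangles $ABC$ and $A_1B_1C_1$ are homological has, in barycentric coordinates, the equation $$\frac{\alpha}{a}\left(\frac{\gamma^2}{c^2}-\frac{\beta^2}{b^2}\right)(\cos A-\cos B\cos C)+\frac{\beta}{b}\left(\frac{\alpha^2}{a^2}-\frac{\gamma^2}{c^2}\right)(\cos B-\cos A\cos C)+\frac{\gamma}{c}\left(\frac{\beta^2}{b^2}-\frac{\alpha^2}{a^2}\right)(\cos C-\cos A\cos B)=0.$$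
   Context: Barycentric coordinates are taken with $A=(1,0,0)$, $B=(0,1,0)$, $C=(0,0,1)$, so that $P=\alpha A+\beta B+\gamma C$ with $\alpha+\beta+\gamma=1$. The pedal triangle $A_1B_1C_1$ of $P$ has as vertices the feet $A_1,B_1,C_1$ of the perpendiculars from $P$ to the lines $BC,CA,AB$ respectively. The triangles $ABC$ and $A_1B_1C_1$ are homological if the lines $AA_1$, $BB_1$, $CC_1$ are concurrent in a point (the homological center).
   Formalization: Concurrency is read projectively: the homological center may be a point at infinity, so the triangles also count as homological when AA1, BB1, CC1 are parallel; with finite centers only, the cubic contains points outside the locus. *)

theory Defs
  imports "HOL-Analysis.Analysis"
begin

definition line_through :: "real^2 \<Rightarrow> real^2 \<Rightarrow> (real^2) set" where
  "line_through X Y = affine hull {X, Y}"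

definition angle_at :: "real^2 \<Rightarrow> real^2 \<Rightarrow> real^2 \<Rightarrow> real" where
  "angle_at Y X Z = arccos (((X - Y) \<bullet> (Z - Y)) / (norm (X - Y) * norm (Z - Y)))"

definition foot :: "real^2 \<Rightarrow> real^2 \<Rightarrow> real^2 \<Rightarrow> real^2" where
  "foot P X Y = (THE F. F \<in> line_through X Y \<and> orthogonal (P - F) (Y - X))"

(* Concurrency is projective: the common point may be the point at infinity in
   direction v, i.e. the lines may be parallel.  Reading it affinely would make the
   locus a proper subset of the cubic: for the equilateral triangle A = (0, sqrt 3),
   B = (-1, 0), C = (1, 0), the point P = (0, 7 / sqrt 3) lies on the cubic, but the lines
   joining the vertices to the feet are three distinct vertical lines. *)

definition concurrent :: "(real^2) set \<Rightarrow> (real^2) set \<Rightarrow> (real^2) set \<Rightarrow> bool" where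
  "concurrent l m n \<longleftrightarrow>
     (\<exists>Q. Q \<in> l \<and> Q \<in> m \<and> Q \<in> n) \<or>
     (\<exists>v. v \<noteq> 0 \<and> (\<forall>L\<in>{l, m, n}. \<forall>X\<in>L. X + v \<in> L))"

(* The inequalities say that the three joining lines are defined; for a pedal triangle of
   a nondegenerate triangle they always hold. *)

definition homological ::
  "real^2 \<Rightarrow> real^2 \<Rightarrow> real^2 \<Rightarrow> real^2 \<Rightarrow> real^2 \<Rightarrow> real^2 \<Rightarrow> bool" where
  "homological A B C A1 B1 C1 \<longleftrightarrow>
     A \<noteq> A1 \<and> B \<noteq> B1 \<and> C \<noteq> C1 \<and>
     concurrent (line_through A A1) (line_through B B1) (line_through C C1)"

definition pedal_homology_locus :: "real^2 \<Rightarrow> real^2 \<Rightarrow> real^2 \<Rightarrow> (real^2) set" where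
  "pedal_homology_locus A B C =
     {P. homological A B C (foot P B C) (foot P C A) (foot P A B)}"

end

theory Submission
  imports Defs
begin

text \<open>Put \<open>x = \<alpha>/a\<close>, \<open>y = \<beta>/b\<close>, \<open>z = \<gamma>/c\<close>. The foot of the perpendicular from \<open>P\<close> to \<open>BC\<close>
  divides \<open>BC\<close> in the ratio \<open>c (z + x cos B) : b (y + x cos C)\<close>, and cyclically for the other feet.
  By Ceva's theorem in its projective form, where the cevians may also be parallel, the triangles are
  homological if and only if
  \<open>(z + x cos B)(x + y cos C)(y + z cos A) = (y + x cos C)(z + y cos A)(x + z cos B)\<close>.
  In the difference of the two sides the \<open>xyz\<close> terms cancel, and what remains is the cubic.\<close>

section \<open>Lines and feet of perpendiculars\<close>

lemma line_through_iff:
  "Z \<in> line_through X Y \<longleftrightarrow> (\<exists>k. Z = X + k *\<^sub>R (Y - X))"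
proof -
  have "Z \<in> line_through X Y \<longleftrightarrow> (\<exists>u v. Z = u *\<^sub>R X + v *\<^sub>R Y \<and> u + v = 1)"
    by (auto simp: line_through_def affine_hull_2)
  also have "\<dots> \<longleftrightarrow> (\<exists>k. Z = (1 - k) *\<^sub>R X + k *\<^sub>R Y)"
  proof -
    have "u + v = 1 \<longleftrightarrow> u = 1 - v" for u v :: real by auto
    then show ?thesis by auto
  qed
  finally show ?thesis by (simp add: algebra_simps)
qed

lemma foot_eq:
  assumes "X \<noteq> Y"
  shows "foot P X Y = X + (((P - X) \<bullet> (Y - X)) / (dist X Y)\<^sup>2) *\<^sub>R (Y - X)"
proof -
  define n where "n = (Y - X) \<bullet> (Y - X)"
  have n: "n \<noteq> 0" "(dist X Y)\<^sup>2 = n"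
    using assms by (auto simp: n_def dist_norm norm_minus_commute[of X] power2_norm_eq_inner)
  \<comment> \<open>Along the line, orthogonality is a linear equation in \<open>k\<close> with
    leading coefficient \<open>n\<close>. Its single root gives both existence and uniqueness for
    the \<open>THE\<close> in \<open>foot\<close>.\<close>
  have orth: "orthogonal (P - (X + k *\<^sub>R (Y - X))) (Y - X) \<longleftrightarrow> k = ((P - X) \<bullet> (Y - X)) / n" for k
  proof -
    have "(P - (X + k *\<^sub>R (Y - X))) \<bullet> (Y - X) = (P - X) \<bullet> (Y - X) - k * n"
      unfolding n_def by (simp add: inner_diff_left inner_add_left algebra_simps)
    then show ?thesis using n by (auto simp: orthogonal_def field_simps)
  qed
  show ?thesis
    unfolding foot_def n by (rule the_equality) (auto simp: line_through_iff orth)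
qed

section \<open>Barycentric coordinates of points and vectors\<close>

lemma barycentric_unique:
  fixes A B C :: "real^2"
  assumes "\<not> collinear {A, B, C}" "x + y + z = 0" "x *\<^sub>R A + y *\<^sub>R B + z *\<^sub>R C = 0"
  shows "x = 0 \<and> y = 0 \<and> z = 0"
proof (rule ccontr)
  assume nz: "\<not> ?thesis"
  have d: "A \<noteq> B" "B \<noteq> C" "A \<noteq> C"
    using assms(1) by (auto simp: insert_commute)
  define u where "u = (\<lambda>X. if X = A then x else if X = B then y else z)"
  have u: "u A = x" "u B = y" "u C = z" using d by (auto simp: u_def)
  have "sum u {A, B, C} = 0" "(\<Sum>v\<in>{A, B, C}. u v *\<^sub>R v) = 0"
    using d assms(2,3) by (simp_all add: u add.assoc)
  moreover have "\<exists>v\<in>{A, B, C}. u v \<noteq> 0" using nz u by auto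
  ultimately have "affine_dependent {A, B, C}"
    using affine_dependent_explicit_finite[of "{A, B, C}"] by blast
  then show False
    using assms(1) d by (auto simp: collinear_3_eq_affine_dependent)
qed

lemma barycentric_exists:
  fixes A B C :: "real^2"
  assumes "\<not> collinear {A, B, C}"
  obtains x y z where "x + y + z = 1" "X = x *\<^sub>R A + y *\<^sub>R B + z *\<^sub>R C"
proof -
  have d: "A \<noteq> B" "B \<noteq> C" "A \<noteq> C"
    using assms by (auto simp: insert_commute)
  have "affine hull {A, B, C} = UNIV"
    using assms d
    by (intro affine_independent_span_eq) (auto simp: collinear_3_eq_affine_dependent)
  then have "X \<in> affine hull {A, B, C}" by simp
  then show thesis using that by (auto simp: affine_hull_3)
qed

text \<open>Weight-zero triples encode vectors, hence points at infinity. They arise as coordinates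
  of \<open>A + v\<close> minus those of \<open>A\<close>.\<close>

lemma barycentric_direction_exists:
  fixes A B C :: "real^2"
  assumes "\<not> collinear {A, B, C}"
  obtains x y z where "x + y + z = 0" "v = x *\<^sub>R A + y *\<^sub>R B + z *\<^sub>R C"
proof -
  obtain x y z where "x + y + z = 1" "A + v = x *\<^sub>R A + y *\<^sub>R B + z *\<^sub>R C"
    using barycentric_exists[OF assms] .
  then show thesis
    using that[of "x - 1" y z] by (simp add: algebra_simps)
qed

section \<open>Cevians in coordinates\<close>

text \<open>Along a cevian from \<open>A\<close> the ratio of the other two coordinates stays what
  it is at the foot, \<open>(1 - s) : s\<close>. The cross-multiplied form also covers feet at
  \<open>B\<close> or \<open>C\<close>.\<close>

lemma mem_cevian_iff:
  fixes A B C :: "real^2"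
  assumes "\<not> collinear {A, B, C}" "x + y + z = 1"
  shows "x *\<^sub>R A + y *\<^sub>R B + z *\<^sub>R C \<in> line_through A ((1 - s) *\<^sub>R B + s *\<^sub>R C)
    \<longleftrightarrow> s * y = (1 - s) * z"
proof
  assume "x *\<^sub>R A + y *\<^sub>R B + z *\<^sub>R C \<in> line_through A ((1 - s) *\<^sub>R B + s *\<^sub>R C)"
  then obtain k where "x *\<^sub>R A + y *\<^sub>R B + z *\<^sub>R C = A + k *\<^sub>R ((1 - s) *\<^sub>R B + s *\<^sub>R C - A)"
    by (auto simp: line_through_iff)
  then have "(x - 1 + k) *\<^sub>R A + (y - k * (1 - s)) *\<^sub>R B + (z - k * s) *\<^sub>R C = 0"
    by (simp add: algebra_simps)
  moreover have "(x - 1 + k) + (y - k * (1 - s)) + (z - k * s) = 0"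
    using assms(2) by (simp add: algebra_simps)
  ultimately have "y - k * (1 - s) = 0 \<and> z - k * s = 0"
    using barycentric_unique[OF assms(1)] by blast
  then have "y = k * (1 - s)" "z = k * s" by simp_all
  then show "s * y = (1 - s) * z" by simp
next
  assume e: "s * y = (1 - s) * z"
  \<comment> \<open>The parameter along the cevian: 0 at \<open>A\<close>, 1 at the foot.\<close>
  define k where "k = y + z"
  have xyz: "x = 1 - k" "y = k * (1 - s)" "z = k * s"
    using e assms(2) by (auto simp: k_def algebra_simps)
  have "x *\<^sub>R A + y *\<^sub>R B + z *\<^sub>R C = A + k *\<^sub>R ((1 - s) *\<^sub>R B + s *\<^sub>R C - A)"
    unfolding xyz by (simp add: algebra_simps)
  then show "x *\<^sub>R A + y *\<^sub>R B + z *\<^sub>R C \<in> line_through A ((1 - s) *\<^sub>R B + s *\<^sub>R C)"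
    by (auto simp: line_through_iff)
qed

text \<open>The equation of a cevian is homogeneous in \<open>y\<close> and \<open>z\<close>, so a
  vector preserves the line exactly when it solves the same equation. Finite points and points at
  infinity thus share one linear system.\<close>

lemma cevian_direction_iff:
  fixes A B C :: "real^2" and s :: real
  assumes "\<not> collinear {A, B, C}" "x + y + z = 0"
  defines "L \<equiv> line_through A ((1 - s) *\<^sub>R B + s *\<^sub>R C)"
  shows "(\<forall>X\<in>L. X + (x *\<^sub>R A + y *\<^sub>R B + z *\<^sub>R C) \<in> L) \<longleftrightarrow> s * y = (1 - s) * z"
proof
  assume *: "\<forall>X\<in>L. X + (x *\<^sub>R A + y *\<^sub>R B + z *\<^sub>R C) \<in> L"
  \<comment> \<open>\<open>A\<close> serves as test point: both its coordinates in the equation are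
    0, so its translate has those of the vector.\<close>
  have "A \<in> L" by (simp add: L_def line_through_def hull_inc)
  with * have "(1 + x) *\<^sub>R A + y *\<^sub>R B + z *\<^sub>R C \<in> L"
    by (auto simp: algebra_simps)
  then show "s * y = (1 - s) * z"
    using mem_cevian_iff[OF assms(1), of "1 + x" y z] assms(2) by (simp add: L_def)
next
  assume e: "s * y = (1 - s) * z"
  show "\<forall>X\<in>L. X + (x *\<^sub>R A + y *\<^sub>R B + z *\<^sub>R C) \<in> L"
  proof
    fix X assume X: "X \<in> L"
    obtain p q r where p: "p + q + r = 1" and Xe: "X = p *\<^sub>R A + q *\<^sub>R B + r *\<^sub>R C"
      using barycentric_exists[OF assms(1)] .
    have "s * q = (1 - s) * r"
      using X mem_cevian_iff[OF assms(1) p] by (simp add: Xe L_def)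
    then have "s * (q + y) = (1 - s) * (r + z)"
      using e by (simp add: algebra_simps)
    moreover have "(p + x) + (q + y) + (r + z) = 1" using p assms(2) by simp
    ultimately have "(p + x) *\<^sub>R A + (q + y) *\<^sub>R B + (r + z) *\<^sub>R C \<in> L"
      using mem_cevian_iff[OF assms(1)] unfolding L_def by blast
    then show "X + (x *\<^sub>R A + y *\<^sub>R B + z *\<^sub>R C) \<in> L"
      by (simp add: Xe algebra_simps)
  qed
qed

section \<open>Ceva's theorem in projective form\<close>

lemma ceva_system_iff:
  fixes s t r :: real
  shows "(\<exists>x y z. (x, y, z) \<noteq> (0, 0, 0) \<and>
      s * y = (1 - s) * z \<and> t * z = (1 - t) * x \<and> r * x = (1 - r) * y)
    \<longleftrightarrow> s * t * r = (1 - s) * (1 - t) * (1 - r)"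
    (is "?L \<longleftrightarrow> ?R")
proof
  assume ?L
  then obtain x y z where nz: "x \<noteq> 0 \<or> y \<noteq> 0 \<or> z \<noteq> 0"
    and e: "s * y = (1 - s) * z" "t * z = (1 - t) * x" "r * x = (1 - r) * y" by auto
  \<comment> \<open>\<open>d\<close> is the determinant of the system; the multipliers below are the
    entries of its adjugate, as in Cramer's rule.\<close>
  define d where "d = s * t * r - (1 - s) * (1 - t) * (1 - r)"
  have "d * x = s * t * (r * x - (1 - r) * y) + t * (1 - r) * (s * y - (1 - s) * z)
      + (1 - r) * (1 - s) * (t * z - (1 - t) * x)"
    "d * y = t * r * (s * y - (1 - s) * z) + r * (1 - s) * (t * z - (1 - t) * x)
      + (1 - s) * (1 - t) * (r * x - (1 - r) * y)"
    "d * z = r * s * (t * z - (1 - t) * x) + s * (1 - t) * (r * x - (1 - r) * y)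
      + (1 - t) * (1 - r) * (s * y - (1 - s) * z)"
    unfolding d_def by (simp_all add: algebra_simps)
  then have "d * x = 0" "d * y = 0" "d * z = 0"
    by (simp_all only: e diff_self mult_zero_right add_0)
  then show ?R using nz by (auto simp: d_def)
next
  assume R: ?R
  \<comment> \<open>A solution is the cross product of the first two rows of the coefficient matrix,
    unless these are proportional, which happens only for \<open>s = 0\<close> and \<open>t = 1\<close>.\<close>
  show ?L
  proof (cases "s = 0 \<and> t = 1")
    case True
    \<comment> \<open>Here the first two equations both reduce to \<open>z = 0\<close>; the pair
      \<open>(1 - r, r)\<close> solves the third and never vanishes.\<close>
    then show ?thesis
      by (intro exI[of _ "1 - r"] exI[of _ r] exI[of _ 0]) auto
  next
    case False
    have "(s * t, (1 - s) * (1 - t), s * (1 - t)) \<noteq> (0, 0, 0)"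
      using False by auto
    moreover have "s * ((1 - s) * (1 - t)) = (1 - s) * (s * (1 - t))"
      "t * (s * (1 - t)) = (1 - t) * (s * t)"
      by (simp_all only: ac_simps)
    moreover have "r * (s * t) = (1 - r) * ((1 - s) * (1 - t))"
      using R by (simp only: ac_simps)
    ultimately show ?thesis by blast
  qed
qed

text \<open>A nonzero solution of the system is a common projective point of the cevians: a finite
  one if its coordinate sum is nonzero, otherwise a common direction.\<close>

lemma projective_ceva:
  fixes A B C :: "real^2"
  assumes nc: "\<not> collinear {A, B, C}"
  shows "concurrent (line_through A ((1 - s) *\<^sub>R B + s *\<^sub>R C))
      (line_through B ((1 - t) *\<^sub>R C + t *\<^sub>R A)) (line_through C ((1 - r) *\<^sub>R A + r *\<^sub>R B))
    \<longleftrightarrow> s * t * r = (1 - s) * (1 - t) * (1 - r)"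
    (is "concurrent ?l ?m ?n \<longleftrightarrow> _")
proof -
  have nc2: "\<not> collinear {B, C, A}" and nc3: "\<not> collinear {C, A, B}"
    using nc by (simp_all add: insert_commute)
  let ?X = "\<lambda>x y z. x *\<^sub>R A + y *\<^sub>R B + z *\<^sub>R C"
  let ?S = "\<lambda>x y z. s * y = (1 - s) * z \<and> t * z = (1 - t) * x \<and> r * x = (1 - r) * y"
  \<comment> \<open>Cyclic rotation carries the criteria for cevians from \<open>A\<close> over to
    those from \<open>B\<close> and \<open>C\<close>.\<close>
  have rot: "?X x y z = y *\<^sub>R B + z *\<^sub>R C + x *\<^sub>R A" "?X x y z = z *\<^sub>R C + x *\<^sub>R A + y *\<^sub>R B" for x y z
    by simp_all
  have pt: "(?X x y z \<in> ?l \<and> ?X x y z \<in> ?m \<and> ?X x y z \<in> ?n) \<longleftrightarrow> ?S x y z"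
    if "x + y + z = 1" for x y z
  proof -
    have "y + z + x = 1" "z + x + y = 1" using that by simp_all
    then show ?thesis
      using mem_cevian_iff[OF nc that, of s] mem_cevian_iff[OF nc2, of y z x t]
        mem_cevian_iff[OF nc3, of z x y r]
      unfolding rot[of x y z, symmetric] by blast
  qed
  have dir: "(\<forall>L\<in>{?l, ?m, ?n}. \<forall>X\<in>L. X + ?X x y z \<in> L) \<longleftrightarrow> ?S x y z"
    if "x + y + z = 0" for x y z
  proof -
    have "y + z + x = 0" "z + x + y = 0" using that by simp_all
    then show ?thesis
      using cevian_direction_iff[OF nc that, of s] cevian_direction_iff[OF nc2, of y z x t]
        cevian_direction_iff[OF nc3, of z x y r]
      unfolding rot[of x y z, symmetric] by (simp only: ball_simps simp_thms)
  qed
  have "concurrent ?l ?m ?n \<longleftrightarrow> (\<exists>x y z. (x, y, z) \<noteq> (0, 0, 0) \<and> ?S x y z)"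
  proof
    assume "concurrent ?l ?m ?n"
    then consider Q where "Q \<in> ?l \<and> Q \<in> ?m \<and> Q \<in> ?n"
      | v where "v \<noteq> 0" "\<forall>L\<in>{?l, ?m, ?n}. \<forall>X\<in>L. X + v \<in> L"
      unfolding concurrent_def by blast
    then show "\<exists>x y z. (x, y, z) \<noteq> (0, 0, 0) \<and> ?S x y z"
    proof cases
      case (1 Q)
      obtain x y z where "x + y + z = 1" "Q = ?X x y z" using barycentric_exists[OF nc] .
      with 1 have "?S x y z" "(x, y, z) \<noteq> (0, 0, 0)" using pt by auto
      then show ?thesis by blast
    next
      case (2 v)
      obtain x y z where "x + y + z = 0" "v = ?X x y z" using barycentric_direction_exists[OF nc] .
      with 2 have "?S x y z" "(x, y, z) \<noteq> (0, 0, 0)" using dir by auto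
      then show ?thesis by blast
    qed
  next
    assume "\<exists>x y z. (x, y, z) \<noteq> (0, 0, 0) \<and> ?S x y z"
    then obtain x y z where nz: "(x, y, z) \<noteq> (0, 0, 0)" and S: "?S x y z" by blast
    show "concurrent ?l ?m ?n"
    proof (cases "x + y + z = 0")
      case True
      then have "?X x y z \<noteq> 0" using barycentric_unique[OF nc] nz by blast
      then show ?thesis using iffD2[OF dir[OF True] S] unfolding concurrent_def by blast
    next
      case False
      \<comment> \<open>Homogeneity of the system allows rescaling to weight 1.\<close>
      define w where "w = x + y + z"
      have "x / w + y / w + z / w = 1"
        using False by (simp add: w_def flip: add_divide_distrib)
      moreover have "?S (x / w) (y / w) (z / w)" using S by simp
      ultimately show ?thesis unfolding concurrent_def using iffD2[OF pt] by blast
    qed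
  qed
  then show ?thesis by (simp only: ceva_system_iff)
qed

section \<open>Feet of the pedal triangle\<close>

lemma pedal_foot_barycentric:
  fixes A B C :: "real^2"
  assumes "B \<noteq> C" "\<alpha> + \<beta> + \<gamma> = 1" "P = \<alpha> *\<^sub>R A + \<beta> *\<^sub>R B + \<gamma> *\<^sub>R C"
  defines "s \<equiv> \<gamma> + \<alpha> * (((A - B) \<bullet> (C - B)) / (dist B C)\<^sup>2)"
  shows "foot P B C = (1 - s) *\<^sub>R B + s *\<^sub>R C"
proof -
  have \<beta>: "\<beta> = 1 - \<alpha> - \<gamma>" using assms(2) by simp
  \<comment> \<open>Projecting onto \<open>BC\<close>, the second term contributes
    \<open>\<gamma>\<close> and the first \<open>\<alpha>\<close> times the projection of
    \<open>A\<close>.\<close>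
  have P: "P - B = \<alpha> *\<^sub>R (A - B) + \<gamma> *\<^sub>R (C - B)"
    unfolding assms(3) \<beta> by (simp add: algebra_simps)
  have "(C - B) \<bullet> (C - B) = (dist B C)\<^sup>2"
    by (simp add: dist_norm norm_minus_commute[of B] power2_norm_eq_inner)
  then have "(P - B) \<bullet> (C - B) / (dist B C)\<^sup>2 = s"
    using assms(1) by (simp add: P s_def inner_add_left add_divide_distrib)
  then show ?thesis
    using foot_eq[OF assms(1), of P] by (simp add: algebra_simps)
qed

lemma cos_angle_at:
  "cos (angle_at Y X Z) = ((X - Y) \<bullet> (Z - Y)) / (dist Y X * dist Y Z)"
proof -
  have "\<bar>(X - Y) \<bullet> (Z - Y)\<bar> \<le> norm (X - Y) * norm (Z - Y)" by (rule Cauchy_Schwarz_ineq2)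
  \<comment> \<open>If an arm of the angle has length 0, the quotient is 0 by the convention for
    division by zero.\<close>
  then have "\<bar>(X - Y) \<bullet> (Z - Y) / (norm (X - Y) * norm (Z - Y))\<bar> \<le> 1"
    by (cases "norm (X - Y) * norm (Z - Y) = 0") (auto simp: divide_le_eq_1 less_le)
  then show ?thesis
    unfolding angle_at_def by (simp add: cos_arccos_abs dist_norm norm_minus_commute)
qed

lemma pedal_ratios:
  fixes A B C :: "real^2"
  assumes "B \<noteq> C" "C \<noteq> A" "A \<noteq> B" "\<alpha> + \<beta> + \<gamma> = 1"
  defines "s \<equiv> \<gamma> + \<alpha> * (((A - B) \<bullet> (C - B)) / (dist B C)\<^sup>2)"
  shows "s = dist A B * (\<gamma> / dist A B + \<alpha> / dist B C * cos (angle_at B C A))"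
    and "1 - s = dist C A * (\<beta> / dist C A + \<alpha> / dist B C * cos (angle_at C A B))"
proof -
  have nz: "dist B C \<noteq> 0" "dist C A \<noteq> 0" "dist A B \<noteq> 0" using assms by auto
  show "s = dist A B * (\<gamma> / dist A B + \<alpha> / dist B C * cos (angle_at B C A))"
    using nz unfolding s_def cos_angle_at
    by (simp add: inner_commute dist_commute field_simps power2_eq_square)
  \<comment> \<open>The projection formula \<open>a = c cos B + b cos C\<close>, multiplied by
    \<open>a\<close>.\<close>
  have "(A - B) \<bullet> (C - B) + (A - C) \<bullet> (B - C) = (dist B C)\<^sup>2"
    by (simp add: dist_norm power2_norm_eq_inner inner_diff_left inner_diff_right inner_commute)
  then have e: "(A - B) \<bullet> (C - B) = (dist B C)\<^sup>2 - (A - C) \<bullet> (B - C)" by simp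
  have "s = \<gamma> + \<alpha> - \<alpha> * ((A - C) \<bullet> (B - C) / (dist B C)\<^sup>2)"
    using nz unfolding s_def e by (simp add: diff_divide_distrib right_diff_distrib)
  then have "1 - s = \<beta> + \<alpha> * ((A - C) \<bullet> (B - C) / (dist B C)\<^sup>2)"
    using assms(4) by simp
  also have "\<dots> = dist C A * (\<beta> / dist C A + \<alpha> / dist B C * cos (angle_at C A B))"
    using nz unfolding cos_angle_at
    by (simp add: dist_commute field_simps power2_eq_square)
  finally show "1 - s = dist C A * (\<beta> / dist C A + \<alpha> / dist B C * cos (angle_at C A B))" .
qed

text \<open>Supplies the inequalities in \<open>homological\<close>, since each foot lies on the
  side line opposite its vertex.\<close>

lemma not_on_opposite_side:
  fixes A B C :: "real^2"
  assumes "\<not> collinear {A, B, C}"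
  shows "A \<noteq> (1 - s) *\<^sub>R B + s *\<^sub>R C"
proof
  assume "A = (1 - s) *\<^sub>R B + s *\<^sub>R C"
  then have "(-1) *\<^sub>R A + (1 - s) *\<^sub>R B + s *\<^sub>R C = 0" by simp
  then show False using barycentric_unique[OF assms, of "-1" "1 - s" s] by simp
qed

section \<open>Equation of the locus\<close>

theorem mainTheorem1:
  fixes A B C P :: "real^2"
    and a b c \<theta>A \<theta>B \<theta>C \<alpha> \<beta> \<gamma> :: real
  assumes "\<not> collinear {A, B, C}"
    and "a = dist B C" and "b = dist C A" and "c = dist A B"
    and "\<theta>A = angle_at A B C" and "\<theta>B = angle_at B C A" and "\<theta>C = angle_at C A B"
    and "\<alpha> + \<beta> + \<gamma> = 1"
    and "P = \<alpha> *\<^sub>R A + \<beta> *\<^sub>R B + \<gamma> *\<^sub>R C"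
  shows "P \<in> pedal_homology_locus A B C \<longleftrightarrow>
    \<alpha> / a * (\<gamma>\<^sup>2 / c\<^sup>2 - \<beta>\<^sup>2 / b\<^sup>2) * (cos \<theta>A - cos \<theta>B * cos \<theta>C)
    + \<beta> / b * (\<alpha>\<^sup>2 / a\<^sup>2 - \<gamma>\<^sup>2 / c\<^sup>2) * (cos \<theta>B - cos \<theta>A * cos \<theta>C)
    + \<gamma> / c * (\<beta>\<^sup>2 / b\<^sup>2 - \<alpha>\<^sup>2 / a\<^sup>2) * (cos \<theta>C - cos \<theta>A * cos \<theta>B) = 0"
proof -
  note nc = assms(1)
  have nc2: "\<not> collinear {B, C, A}" and nc3: "\<not> collinear {C, A, B}"
    using nc by (simp_all add: insert_commute)
  have d: "B \<noteq> C" "C \<noteq> A" "A \<noteq> B" using nc by (auto simp: insert_commute)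
  have nz: "a \<noteq> 0" "b \<noteq> 0" "c \<noteq> 0" using d assms(2-4) by auto
  define s where "s = \<gamma> + \<alpha> * (((A - B) \<bullet> (C - B)) / (dist B C)\<^sup>2)"
  define t where "t = \<alpha> + \<beta> * (((B - C) \<bullet> (A - C)) / (dist C A)\<^sup>2)"
  define r where "r = \<beta> + \<gamma> * (((C - A) \<bullet> (B - A)) / (dist A B)\<^sup>2)"
  \<comment> \<open>Up to the common factor of twice the area, these are the signed distances from
    \<open>P\<close> to the sides.\<close>
  define x y z where "x = \<alpha> / a" and "y = \<beta> / b" and "z = \<gamma> / c"
  have sum: "\<beta> + \<gamma> + \<alpha> = 1" "\<gamma> + \<alpha> + \<beta> = 1" using assms(8) by simp_all
  have feet: "foot P B C = (1 - s) *\<^sub>R B + s *\<^sub>R C" "foot P C A = (1 - t) *\<^sub>R C + t *\<^sub>R A"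
    "foot P A B = (1 - r) *\<^sub>R A + r *\<^sub>R B"
    unfolding s_def t_def r_def
    using pedal_foot_barycentric[OF d(1) assms(8,9)]
      pedal_foot_barycentric[OF d(2) sum(1), of P B]
      pedal_foot_barycentric[OF d(3) sum(2), of P C] assms(9)
    by (simp_all add: algebra_simps)
  have s: "s = c * (z + x * cos \<theta>B)" "1 - s = b * (y + x * cos \<theta>C)"
    using pedal_ratios[OF d assms(8)] by (simp_all add: s_def assms(2-7) x_def y_def z_def)
  have t: "t = a * (x + y * cos \<theta>C)" "1 - t = c * (z + y * cos \<theta>A)"
    using pedal_ratios[OF d(2,3,1) sum(1)] by (simp_all add: t_def assms(2-7) x_def y_def z_def)
  have r: "r = b * (y + z * cos \<theta>A)" "1 - r = a * (x + z * cos \<theta>B)"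
    using pedal_ratios[OF d(3,1,2) sum(2)] by (simp_all add: r_def assms(2-7) x_def y_def z_def)
  have "P \<in> pedal_homology_locus A B C \<longleftrightarrow> s * t * r = (1 - s) * (1 - t) * (1 - r)"
    unfolding pedal_homology_locus_def homological_def mem_Collect_eq feet
    by (simp only: projective_ceva[OF nc] not_on_opposite_side[OF nc]
        not_on_opposite_side[OF nc2] not_on_opposite_side[OF nc3] simp_thms)
  \<comment> \<open>Each triple product contains \<open>a\<close>, \<open>b\<close> and
    \<open>c\<close> once, so the difference of the two sides is \<open>a * b * c\<close> times the
    cubic.\<close>
  also have "\<dots> \<longleftrightarrow> (a * b * c) *
      (x * (z\<^sup>2 - y\<^sup>2) * (cos \<theta>A - cos \<theta>B * cos \<theta>C)
      + y * (x\<^sup>2 - z\<^sup>2) * (cos \<theta>B - cos \<theta>A * cos \<theta>C)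
      + z * (y\<^sup>2 - x\<^sup>2) * (cos \<theta>C - cos \<theta>A * cos \<theta>B)) = 0"
    \<comment> \<open>The complements are rewritten first, because \<open>1 - s\<close> would no
      longer match once \<open>s\<close> is expanded.\<close>
    unfolding s(2) t(2) r(2) unfolding s(1) t(1) r(1)
    by algebra
  also have "\<dots> \<longleftrightarrow> x * (z\<^sup>2 - y\<^sup>2) * (cos \<theta>A - cos \<theta>B * cos \<theta>C)
      + y * (x\<^sup>2 - z\<^sup>2) * (cos \<theta>B - cos \<theta>A * cos \<theta>C)
      + z * (y\<^sup>2 - x\<^sup>2) * (cos \<theta>C - cos \<theta>A * cos \<theta>B) = 0"
    using nz by simp
  finally show ?thesis by (simp only: x_def y_def z_def power_divide)
qed

end
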